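(* The ensemble average of the material derivative of a cosmological fluid field $f(x^i,t)$ is given by the formula $$\Big\langle\frac{df}{dt}\Big\rangle_E=\Big\langle\frac{\partial f}{\partial t}+u^i\frac{\partial f}{\partial x^i}\Big\rangle_E=\frac{d\langle f\rangle_E}{dt}+\Big\langle u^i\frac{\partial f}{\partial x^i}\Big\rangle_E-\langle u^i\rangle_E\frac{\partial\langle f\rangle_E}{\partial x^i},$$ where $\big\langle u^i\frac{\partial f}{\partial x^i}\big\rangle_E=\big\langle u^i\frac{\partial f}{\partial x^i}\big\rangle_E(x^j,t)$ is the single-point second order ensemble correlation function of the fluid velocity $u^i(x^j,t)$ and the spatial derivative $\partial f/\partial x^i$, and the material derivative of $\langle f\rangle_E(x^i,t)$ is $$\frac{d\langle f\rangle_E}{dt}=\frac{\partial\langle f\rangle_E}{\partial t}+\langle u^i\rangle_E\frac{\partial\langle f\rangle_E}{\partial x^i}.$$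
   Context: $x^i$, $i=1,2,3$, are Cartesian coordinates on three-dimensional Euclidean space and $t$ is time; repeated indices are summed. The cosmological fluid fields, including the components of the fluid velocity $u^i(x^j,t)$, are random fields: each field $f$ has, for all times and positions, a probability density $P_{(x^i,t)}(f)$ of the value $f(x^i,t)$, and correlated fields $f,h$ have joint probability densities $P_{(x^i,t)(y^j,s)}(f,h)$. The ensemble average is $\langle f\rangle_E(x^i,t)=\int_{-\infty}^{+\infty} f\,P_{(x^i,t)}(f)\,df$. The two-point second order ensemble correlation function is $\langle fh\rangle_E(x^i,t;y^j,s)=\int\!\!\int fh\,P_{(x^i,t)(y^j,s)}(f,h)\,df\,dh$ (integrals over $(-\infty,+\infty)$); the single-point one is its value at $(y^j,s)=(x^j,t)$. The material derivative of an unaveraged field is $\frac{df}{dt}=\frac{\partial f}{\partial t}+u^i\frac{\partial f}{\partial x^i}$.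
   Formalization: The formal theorem additionally assumes that at each point realisations of f are almost surely differentiable in t and each x^i, with small difference quotients having an integrable majorant; without this, averaging and differentiation need not commute and the formula can fail. *)

theory Defs
  imports "HOL-Probability.Probability"
begin

type_synonym scalar_field = "real ^ 3 \<Rightarrow> real \<Rightarrow> real"
type_synonym vector_field = "real ^ 3 \<Rightarrow> real \<Rightarrow> real ^ 3"

text \<open>
  A random field is a family of fields indexed by the points (realisations) of a probability
  space; the densities below are those of its values at given points of space-time.
\<close>

type_synonym 'w random_scalar = "'w \<Rightarrow> scalar_field"
type_synonym 'w random_vector = "'w \<Rightarrow> vector_field"

definition component :: "'w random_vector \<Rightarrow> 3 \<Rightarrow> 'w random_scalar" where
  "component u i = (\<lambda>\<omega> x t. u \<omega> x t $ i)"

definition partial_t :: "scalar_field \<Rightarrow> scalar_field" where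
  "partial_t g x t = deriv (\<lambda>s. g x s) t"

definition partial_x :: "3 \<Rightarrow> scalar_field \<Rightarrow> scalar_field" where
  "partial_x i g x t = deriv (\<lambda>h. g (x + h *\<^sub>R axis i 1) t) 0"

definition material_derivative :: "vector_field \<Rightarrow> scalar_field \<Rightarrow> scalar_field" where
  "material_derivative v g x t =
     partial_t g x t + (\<Sum>i\<in>UNIV. v x t $ i * partial_x i g x t)"

definition has_density :: "'w measure \<Rightarrow> 'w random_scalar \<Rightarrow> real ^ 3 \<Rightarrow> real \<Rightarrow> bool" where
  "has_density M f x t \<longleftrightarrow> (\<exists>p. distributed M lborel (\<lambda>\<omega>. f \<omega> x t) p)"

text \<open>
  The density is determined up to Lebesgue-null sets, so any version gives the same integrals;
  the Radon-Nikodym derivative of the distribution is used as the version.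
\<close>

definition field_density ::
    "'w measure \<Rightarrow> 'w random_scalar \<Rightarrow> real ^ 3 \<Rightarrow> real \<Rightarrow> real \<Rightarrow> real" where
  "field_density M f x t a =
     enn2real (RN_deriv lborel (distr M lborel (\<lambda>\<omega>. f \<omega> x t)) a)"

definition ensemble_average :: "'w measure \<Rightarrow> 'w random_scalar \<Rightarrow> scalar_field" where
  "ensemble_average M f x t = (LINT a|lborel. a * field_density M f x t a)"

definition ensemble_average_exists ::
    "'w measure \<Rightarrow> 'w random_scalar \<Rightarrow> real ^ 3 \<Rightarrow> real \<Rightarrow> bool" where
  "ensemble_average_exists M f x t \<longleftrightarrow> integrable lborel (\<lambda>a. a * field_density M f x t a)"

definition average_vector :: "'w measure \<Rightarrow> 'w random_vector \<Rightarrow> vector_field" where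
  "average_vector M u x t = (\<chi> i. ensemble_average M (component u i) x t)"

definition has_joint_density ::
    "'w measure \<Rightarrow> 'w random_scalar \<Rightarrow> 'w random_scalar \<Rightarrow>
     real ^ 3 \<Rightarrow> real \<Rightarrow> real ^ 3 \<Rightarrow> real \<Rightarrow> bool" where
  "has_joint_density M f h x t y s \<longleftrightarrow>
     (\<exists>p. distributed M (lborel \<Otimes>\<^sub>M lborel) (\<lambda>\<omega>. (f \<omega> x t, h \<omega> y s)) p)"

definition joint_density ::
    "'w measure \<Rightarrow> 'w random_scalar \<Rightarrow> 'w random_scalar \<Rightarrow>
     real ^ 3 \<Rightarrow> real \<Rightarrow> real ^ 3 \<Rightarrow> real \<Rightarrow> real \<times> real \<Rightarrow> real" where
  "joint_density M f h x t y s z =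
     enn2real (RN_deriv (lborel \<Otimes>\<^sub>M lborel)
       (distr M (lborel \<Otimes>\<^sub>M lborel) (\<lambda>\<omega>. (f \<omega> x t, h \<omega> y s))) z)"

definition ensemble_correlation ::
    "'w measure \<Rightarrow> 'w random_scalar \<Rightarrow> 'w random_scalar \<Rightarrow>
     real ^ 3 \<Rightarrow> real \<Rightarrow> real ^ 3 \<Rightarrow> real \<Rightarrow> real" where
  "ensemble_correlation M f h x t y s =
     (LINT z|(lborel \<Otimes>\<^sub>M lborel). fst z * snd z * joint_density M f h x t y s z)"

definition ensemble_correlation_exists ::
    "'w measure \<Rightarrow> 'w random_scalar \<Rightarrow> 'w random_scalar \<Rightarrow>
     real ^ 3 \<Rightarrow> real \<Rightarrow> real ^ 3 \<Rightarrow> real \<Rightarrow> bool" where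
  "ensemble_correlation_exists M f h x t y s \<longleftrightarrow>
     integrable (lborel \<Otimes>\<^sub>M lborel) (\<lambda>z. fst z * snd z * joint_density M f h x t y s z)"

definition single_point_correlation ::
    "'w measure \<Rightarrow> 'w random_scalar \<Rightarrow> 'w random_scalar \<Rightarrow> scalar_field" where
  "single_point_correlation M f h x t = ensemble_correlation M f h x t x t"

text \<open>
  Regularity of a one-parameter family of random variables at the parameter value \<open>a\<close>: almost
  every realisation is differentiable at \<open>a\<close>, and the difference quotients at \<open>a\<close> with small
  increments have an integrable majorant.  The second clause holds in particular if the
  derivatives of the realisations near \<open>a\<close> have a common integrable majorant.
\<close>

definition regular_at :: "'w measure \<Rightarrow> ('w \<Rightarrow> real \<Rightarrow> real) \<Rightarrow> real \<Rightarrow> bool" where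
  "regular_at M g a \<longleftrightarrow>
     (AE \<omega> in M. g \<omega> differentiable at a) \<and>
     (\<exists>\<delta>>0. \<exists>B. integrable M B \<and>
        (\<forall>h. \<bar>h\<bar> < \<delta> \<longrightarrow> (AE \<omega> in M. \<bar>g \<omega> (a + h) - g \<omega> a\<bar> \<le> B \<omega> * \<bar>h\<bar>)))"

definition regular_field :: "'w measure \<Rightarrow> 'w random_scalar \<Rightarrow> bool" where
  "regular_field M f \<longleftrightarrow>
     (\<forall>x t. regular_at M (\<lambda>\<omega> s. f \<omega> x s) t \<and>
            (\<forall>i. regular_at M (\<lambda>\<omega> h. f \<omega> (x + h *\<^sub>R axis i 1) t) 0))"

end

theory Submission
  imports Defs
begin

text \<open>
  Averages against the densities are expectations over the probability space, so the theorem is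
  linearity of the expectation together with the exchange of expectation and differentiation,
  which holds by dominated convergence of the difference quotients. The time derivative is not
  assumed to be a random variable; it is one because the material derivative and the products
  \<open>u\<^sup>i \<partial>f/\<partial>x\<^sup>i\<close> are.
\<close>

text \<open>Any density \<open>p\<close> makes the distribution absolutely continuous with respect
  to \<open>N\<close>, so the Radon-Nikodym derivative is a density too. It is finite almost
  everywhere because the distribution is a probability measure, hence sigma-finite; passing through
  \<open>enn2real\<close> therefore changes it only on a null set.\<close>

lemma (in prob_space) distributed_RN_deriv:
  assumes "sigma_finite_measure N" and "distributed M N X p"
  shows "distributed M N X (\<lambda>x. ennreal (enn2real (RN_deriv N (distr M N X) x)))"
proof -
  interpret N: sigma_finite_measure N by fact
  have X: "X \<in> measurable M N" and D: "distr M N X = density N p" and p: "p \<in> borel_measurable N"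
    using assms(2) by (auto simp: distributed_def)
  interpret D: prob_space "distr M N X" by (rule prob_space_distr[OF X])
  have ac: "absolutely_continuous N (distr M N X)"
    unfolding D using p by (rule absolutely_continuousI_density)
  have sets: "sets (distr M N X) = sets N" by simp
  have "AE x in N. RN_deriv N (distr M N X) x \<noteq> \<infinity>"
    by (rule N.RN_deriv_finite[OF D.sigma_finite_measure_axioms ac sets])
  then have "density N (\<lambda>x. ennreal (enn2real (RN_deriv N (distr M N X) x)))
      = density N (RN_deriv N (distr M N X))"
    by (intro density_cong) (auto simp: less_top)
  then show ?thesis
    using N.density_RN_deriv[OF ac sets] X by (simp add: distributed_def)
qed

text \<open>Kept general in \<open>N\<close> and \<open>g\<close> so as to cover both kinds of
  average: the identity on the line for a single field, and the product of the coordinates on the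
  plane for a correlation.\<close>

lemma (in prob_space) integral_RN_deriv_distr:
  fixes g :: "'b \<Rightarrow> real"
  assumes "sigma_finite_measure N" and "distributed M N X p" and g: "g \<in> borel_measurable N"
  shows "(LINT x|N. g x * enn2real (RN_deriv N (distr M N X) x)) = expectation (\<lambda>\<omega>. g (X \<omega>))"
    and "integrable N (\<lambda>x. g x * enn2real (RN_deriv N (distr M N X) x))
      \<longleftrightarrow> integrable M (\<lambda>\<omega>. g (X \<omega>))"
  using distributed_integral[OF distributed_RN_deriv[OF assms(1,2)] g]
    distributed_integrable[OF distributed_RN_deriv[OF assms(1,2)] g]
  by (simp_all add: mult.commute)

lemma (in prob_space) ensemble_average_eq_expectation:
  assumes "has_density M f x t"
  shows "ensemble_average M f x t = expectation (\<lambda>\<omega>. f \<omega> x t)"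
    and "ensemble_average_exists M f x t \<longleftrightarrow> integrable M (\<lambda>\<omega>. f \<omega> x t)"
proof -
  obtain p where p: "distributed M lborel (\<lambda>\<omega>. f \<omega> x t) p"
    using assms by (auto simp: has_density_def)
  show "ensemble_average M f x t = expectation (\<lambda>\<omega>. f \<omega> x t)"
    and "ensemble_average_exists M f x t \<longleftrightarrow> integrable M (\<lambda>\<omega>. f \<omega> x t)"
    using integral_RN_deriv_distr[OF sigma_finite_lborel p, of "\<lambda>a. a"]
    by (simp_all add: ensemble_average_def ensemble_average_exists_def field_density_def)
qed

lemma (in prob_space) ensemble_correlation_eq_expectation:
  assumes "has_joint_density M f h x t y s"
  shows "ensemble_correlation M f h x t y s = expectation (\<lambda>\<omega>. f \<omega> x t * h \<omega> y s)"
    and "ensemble_correlation_exists M f h x t y s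
      \<longleftrightarrow> integrable M (\<lambda>\<omega>. f \<omega> x t * h \<omega> y s)"
proof -
  obtain p where p: "distributed M (lborel \<Otimes>\<^sub>M lborel) (\<lambda>\<omega>. (f \<omega> x t, h \<omega> y s)) p"
    using assms by (auto simp: has_joint_density_def)
  have S: "sigma_finite_measure (lborel \<Otimes>\<^sub>M lborel :: (real \<times> real) measure)"
    by (rule lborel_pair.sigma_finite_measure_axioms)
  show "ensemble_correlation M f h x t y s = expectation (\<lambda>\<omega>. f \<omega> x t * h \<omega> y s)"
    and "ensemble_correlation_exists M f h x t y s
      \<longleftrightarrow> integrable M (\<lambda>\<omega>. f \<omega> x t * h \<omega> y s)"
    using integral_RN_deriv_distr[OF S p, of "\<lambda>z. fst z * snd z"]
    by (simp_all add: ensemble_correlation_def ensemble_correlation_exists_def joint_density_def)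
qed

text \<open>Differentiation under the integral sign, with \<open>B\<close> dominating the difference
  quotients. Measurability of the derivative is a separate premise: an almost everywhere limit of
  measurable functions need not be measurable when \<open>M\<close> is not complete.\<close>

lemma regular_at_integral:
  assumes reg: "regular_at M g a"
    and int: "\<And>b. integrable M (\<lambda>\<omega>. g \<omega> b)"
    and meas: "(\<lambda>\<omega>. deriv (g \<omega>) a) \<in> borel_measurable M"
  shows "integrable M (\<lambda>\<omega>. deriv (g \<omega>) a)"
    and "((\<lambda>b. integral\<^sup>L M (\<lambda>\<omega>. g \<omega> b)) has_real_derivative
      integral\<^sup>L M (\<lambda>\<omega>. deriv (g \<omega>) a)) (at a)"
proof -
  let ?D = "\<lambda>\<omega>. deriv (g \<omega>) a"
  let ?q = "\<lambda>h \<omega>. (g \<omega> (a + h) - g \<omega> a) / h"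
  obtain \<delta> B where \<delta>: "\<delta> > 0" and B: "integrable M B"
    and bound: "\<And>h. \<bar>h\<bar> < \<delta> \<Longrightarrow> AE \<omega> in M. \<bar>g \<omega> (a + h) - g \<omega> a\<bar> \<le> B \<omega> * \<bar>h\<bar>"
    using reg unfolding regular_at_def by blast
  have diff: "AE \<omega> in M. (g \<omega> has_real_derivative ?D \<omega>) (at a)"
    using reg unfolding regular_at_def
    by (auto simp: DERIV_deriv_iff_real_differentiable)
  have q_meas: "?q h \<in> borel_measurable M" for h
    using int[of "a + h"] int[of a] by (auto dest: borel_measurable_integrable)
  \<comment> \<open>The null set outside which the bound by \<open>B\<close> holds may depend on the
    increment; along a sequence only countably many such sets occur.\<close>
  have dct: "integrable M ?D \<and> (\<lambda>n. integral\<^sup>L M (?q (h n))) \<longlonglongrightarrow> integral\<^sup>L M ?D"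
    if h: "\<And>n. h n \<noteq> 0" "h \<longlonglongrightarrow> 0" for h :: "nat \<Rightarrow> real"
  proof -
    have "\<forall>\<^sub>F n in sequentially. \<bar>h n\<bar> < \<delta>"
      using h(2) \<delta> by (auto simp: tendsto_iff dist_real_def)
    \<comment> \<open>The bound is available only for increments below \<delta>. Shifting the
      sequence by \<open>N\<close> puts all its terms in that range, and
      \<open>LIMSEQ_offset\<close> later undoes the shift.\<close>
    then obtain N where N: "\<And>n. n \<ge> N \<Longrightarrow> \<bar>h n\<bar> < \<delta>"
      by (auto simp: eventually_sequentially)
    have lim: "AE \<omega> in M. (\<lambda>n. ?q (h (n + N)) \<omega>) \<longlonglongrightarrow> ?D \<omega>"
      using diff
    proof eventually_elim
      case (elim \<omega>)
      then have "((\<lambda>h. ?q h \<omega>) \<longlongrightarrow> ?D \<omega>) (at 0)"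
        by (simp add: DERIV_def)
      moreover have "filterlim (\<lambda>n. h (n + N)) (at 0) sequentially"
        using h(1) LIMSEQ_ignore_initial_segment[OF h(2)] by (simp add: filterlim_at)
      ultimately show ?case by (rule filterlim_compose)
    qed
    have dom: "AE \<omega> in M. norm (?q (h (n + N)) \<omega>) \<le> B \<omega>" for n
      using bound[OF N[of "n + N", simplified]] h(1)[of "n + N"]
      by (auto simp: divide_le_eq)
    have "integrable M ?D"
      by (rule integrable_dominated_convergence[OF meas q_meas B lim dom])
    moreover have "(\<lambda>n. integral\<^sup>L M (?q (h (n + N)))) \<longlonglongrightarrow> integral\<^sup>L M ?D"
      by (rule integral_dominated_convergence[OF meas q_meas B lim dom])
    ultimately show ?thesis
      by (rule conjI[OF _ LIMSEQ_offset[where k = N]])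
  qed
  \<comment> \<open>Integrability does not depend on the sequence, so one with nonzero terms tending
    to zero is enough; here 1/(n+1).\<close>
  show "integrable M ?D"
    using dct[of "\<lambda>n. inverse (real (Suc n))"] LIMSEQ_inverse_real_of_nat by simp
  have "((\<lambda>h. integral\<^sup>L M (?q h)) \<longlongrightarrow> integral\<^sup>L M ?D) (at 0)"
    unfolding tendsto_at_iff_sequentially using dct by (simp add: o_def)
  \<comment> \<open>By linearity the integral of a difference quotient is the difference quotient of
    the integrals.\<close>
  then show "((\<lambda>b. integral\<^sup>L M (\<lambda>\<omega>. g \<omega> b)) has_real_derivative integral\<^sup>L M ?D) (at a)"
    using int by (simp add: DERIV_def)
qed

theorem theorem5:
  fixes M :: "'w measure"
    and f :: "'w random_scalar"
    and u :: "'w random_vector"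
    and x :: "real ^ 3" and t :: real
  assumes "prob_space M"
    and "\<And>y s. has_density M f y s"
    and "\<And>y s. ensemble_average_exists M f y s"
    and "\<And>i y s. has_density M (component u i) y s"
    and "\<And>i y s. ensemble_average_exists M (component u i) y s"
    and "\<And>y s. has_density M (\<lambda>\<omega>. material_derivative (u \<omega>) (f \<omega>)) y s"
    and "\<And>i y s. has_joint_density M (component u i) (\<lambda>\<omega>. partial_x i (f \<omega>)) y s y s"
    and "\<And>i y s. ensemble_correlation_exists M (component u i) (\<lambda>\<omega>. partial_x i (f \<omega>)) y s y s"
    and "regular_field M f"
  shows "ensemble_average_exists M (\<lambda>\<omega>. material_derivative (u \<omega>) (f \<omega>)) x t \<and>
    (\<lambda>s. ensemble_average M f x s) differentiable at t \<and>
    (\<forall>i. (\<lambda>h. ensemble_average M f (x + h *\<^sub>R axis i 1) t) differentiable at 0) \<and>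
    ensemble_average M (\<lambda>\<omega>. material_derivative (u \<omega>) (f \<omega>)) x t =
         ensemble_average M
           (\<lambda>\<omega> y s. partial_t (f \<omega>) y s + (\<Sum>i\<in>UNIV. u \<omega> y s $ i * partial_x i (f \<omega>) y s)) x t \<and>
    ensemble_average M
           (\<lambda>\<omega> y s. partial_t (f \<omega>) y s + (\<Sum>i\<in>UNIV. u \<omega> y s $ i * partial_x i (f \<omega>) y s)) x t =
         material_derivative (average_vector M u) (ensemble_average M f) x t
         + (\<Sum>i\<in>UNIV. single_point_correlation M (component u i) (\<lambda>\<omega>. partial_x i (f \<omega>)) x t)
         - (\<Sum>i\<in>UNIV. ensemble_average M (component u i) x t * partial_x i (ensemble_average M f) x t) \<and>
    material_derivative (average_vector M u) (ensemble_average M f) x t =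
         partial_t (ensemble_average M f) x t
         + (\<Sum>i\<in>UNIV. ensemble_average M (component u i) x t * partial_x i (ensemble_average M f) x t)"
proof -
  interpret prob_space M by fact
  note avg = ensemble_average_eq_expectation
  let ?md = "\<lambda>\<omega>. material_derivative (u \<omega>) (f \<omega>)"
  let ?pt = "\<lambda>\<omega>. partial_t (f \<omega>) x t"
  let ?c = "\<lambda>i \<omega>. component u i \<omega> x t * partial_x i (f \<omega>) x t"
  have f_int: "integrable M (\<lambda>\<omega>. f \<omega> y s)" for y s
    using assms(2,3) avg(2) by blast
  \<comment> \<open>An equality of functions, not just of values at \<open>x\<close> and
    \<open>t\<close>, since the average is going to be differentiated.\<close>
  have avg_f: "ensemble_average M f = (\<lambda>y s. expectation (\<lambda>\<omega>. f \<omega> y s))"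
    using assms(2) avg(1) by blast
  have c_int: "integrable M (?c i)" for i
    using assms(7,8) ensemble_correlation_eq_expectation(2) by blast
  have c_avg: "single_point_correlation M (component u i) (\<lambda>\<omega>. partial_x i (f \<omega>)) x t
      = expectation (?c i)" for i
    unfolding single_point_correlation_def
    using assms(7) by (rule ensemble_correlation_eq_expectation(1))
  \<comment> \<open>A joint density includes measurability of the pair; its second coordinate is the
    spatial derivative.\<close>
  have px_meas: "(\<lambda>\<omega>. partial_x i (f \<omega>) x t) \<in> borel_measurable M" for i
  proof -
    have "(\<lambda>\<omega>. (component u i \<omega> x t, partial_x i (f \<omega>) x t)) \<in> M \<rightarrow>\<^sub>M lborel \<Otimes>\<^sub>M lborel"
      using assms(7)[of i x t] by (auto simp: has_joint_density_def distributed_def)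
    from measurable_compose[OF this measurable_snd] show ?thesis by simp
  qed
  have md_eq: "?md \<omega> x t = ?pt \<omega> + (\<Sum>i\<in>UNIV. ?c i \<omega>)" for \<omega>
    by (simp add: material_derivative_def component_def)
  have md_meas: "(\<lambda>\<omega>. ?md \<omega> x t) \<in> borel_measurable M"
    using assms(6)[of x t] by (auto simp: has_density_def distributed_def)
  \<comment> \<open>By \<open>md_eq\<close> this difference is the time derivative
    \<open>?pt\<close>.\<close>
  have "(\<lambda>\<omega>. ?md \<omega> x t - (\<Sum>i\<in>UNIV. ?c i \<omega>)) \<in> borel_measurable M"
    by (intro borel_measurable_diff borel_measurable_sum md_meas borel_measurable_integrable[OF c_int])
  then have pt_meas: "?pt \<in> borel_measurable M"
    by (simp add: md_eq)
  have reg_t: "regular_at M (\<lambda>\<omega> s. f \<omega> x s) t"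
    and reg_x: "\<And>i. regular_at M (\<lambda>\<omega> h. f \<omega> (x + h *\<^sub>R axis i 1) t) 0"
    using assms(9) by (auto simp: regular_field_def)
  note t_deriv = regular_at_integral[OF reg_t f_int pt_meas[unfolded partial_t_def]]
  note x_deriv = regular_at_integral(2)[OF reg_x f_int px_meas[unfolded partial_x_def]]
  have pt_int: "integrable M ?pt"
    unfolding partial_t_def by (rule t_deriv(1))
  have pt_avg: "partial_t (ensemble_average M f) x t = expectation ?pt"
    unfolding partial_t_def avg_f by (rule DERIV_imp_deriv[OF t_deriv(2)])
  have md_exists: "ensemble_average_exists M ?md x t"
    unfolding avg(2)[OF assms(6)] md_eq using pt_int c_int by auto
  have md_avg: "ensemble_average M ?md x t = expectation ?pt + (\<Sum>i\<in>UNIV. expectation (?c i))"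
    unfolding avg(1)[OF assms(6)] md_eq using pt_int c_int
    by (subst Bochner_Integration.integral_add) auto
  have md_unfold: "?md = (\<lambda>\<omega> y s. partial_t (f \<omega>) y s
      + (\<Sum>i\<in>UNIV. u \<omega> y s $ i * partial_x i (f \<omega>) y s))"
    by (simp add: fun_eq_iff material_derivative_def)
  have avg_md: "material_derivative (average_vector M u) (ensemble_average M f) x t =
      partial_t (ensemble_average M f) x t
      + (\<Sum>i\<in>UNIV. ensemble_average M (component u i) x t * partial_x i (ensemble_average M f) x t)"
    by (simp add: material_derivative_def average_vector_def)
  have diff_t: "(\<lambda>s. ensemble_average M f x s) differentiable at t"
    unfolding avg_f using t_deriv(2) by (auto simp: real_differentiable_def)
  have diff_x: "(\<lambda>h. ensemble_average M f (x + h *\<^sub>R axis i 1) t) differentiable at 0" for i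
    unfolding avg_f using x_deriv[of i] by (auto simp: real_differentiable_def)
  \<comment> \<open>The convective sum inside the material derivative of the average cancels against
    the subtracted sum. What remains is the time derivative of the average, equal to the average of
    \<open>?pt\<close> by \<open>pt_avg\<close>, plus the correlations.\<close>
  have "ensemble_average M ?md x t =
      material_derivative (average_vector M u) (ensemble_average M f) x t
      + (\<Sum>i\<in>UNIV. single_point_correlation M (component u i) (\<lambda>\<omega>. partial_x i (f \<omega>)) x t)
      - (\<Sum>i\<in>UNIV. ensemble_average M (component u i) x t * partial_x i (ensemble_average M f) x t)"
    unfolding md_avg avg_md c_avg pt_avg by simp
  \<comment> \<open>Folding the written-out sum back into \<open>material_derivative\<close> turns
    the first equality of the claim into reflexivity and the second into the identity just
    shown.\<close>
  then show ?thesis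
    unfolding md_unfold[symmetric]
    by (intro conjI allI refl md_exists diff_t diff_x avg_md)
qed

end
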